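(* Let $\pi_1,\pi_2$ be possibility distributions on a finite set $\mathcal{X}$, with induced possibility measures $\Pi_1,\Pi_2$, and let $\overline{P}(A)=\min\{\Pi_1(A),\Pi_2(A)\}$ for all $A\subseteq\mathcal{X}$. Then $\overline{P}$ is a possibility measure if and only if for all non-empty $A\subseteq\mathcal{X}$, the two-player zero-sum game in which player 1 chooses $\alpha\in\{1,2\}$, player 2 chooses $\beta\in A$, and the payoff to player 1 is $a_{\alpha\beta}=-\pi_\alpha(\beta)$, has a pure equilibrium strategy.
   Context: $\mathcal{X}$ is a finite set and $\wp(\mathcal{X})$ its power set. A possibility distribution on $\mathcal{X}$ is a function $\pi\colon\mathcal{X}\to[0,1]$ with $\max_{x\in\mathcal{X}}\pi(x)=1$. It induces the possibility measure $\Pi\colon\wp(\mathcal{X})\to[0,1]$, $\Pi(A)=\max_{x\in A}\pi(x)$, with $\Pi(\emptyset)=0$. A set function is called a possibility measure if it is induced in this way by some possibility distribution. In a zero-sum game in which player 1 chooses $\alpha\in\{1,2\}$ and player 2 chooses $\beta\in A$, with payoff $a_{\alpha\beta}$ to player 1 (player 2 loses $a_{\alpha\beta}$), a pure strategy is a pair $(\alpha,\beta)$. A pure strategy $(\hat\alpha,\hat\beta)$ is in equilibrium (a pure equilibrium strategy) if $$a_{\hat\alpha\hat\beta}=\max_{\alpha\in\{1,2\}}a_{\alpha\hat\beta}=\min_{\beta\in A}a_{\hat\alpha\beta}.$$ *)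

theory Defs
  imports Complex_Main
begin

(* Max {} is unspecified, so non-emptiness, which is implicit in max = 1, is stated explicitly. *)
definition possibility_distribution :: "'a set \<Rightarrow> ('a \<Rightarrow> real) \<Rightarrow> bool" where
  "possibility_distribution X \<pi> \<longleftrightarrow>
     X \<noteq> {} \<and> (\<forall>x\<in>X. 0 \<le> \<pi> x \<and> \<pi> x \<le> 1) \<and> Max (\<pi> ` X) = 1"

definition induced_measure :: "('a \<Rightarrow> real) \<Rightarrow> 'a set \<Rightarrow> real" where
  "induced_measure \<pi> A = (if A = {} then 0 else Max (\<pi> ` A))"

(* Only the values of P on subsets of X matter. *)
definition possibility_measure :: "'a set \<Rightarrow> ('a set \<Rightarrow> real) \<Rightarrow> bool" where
  "possibility_measure X P \<longleftrightarrow>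
     (\<exists>\<pi>. possibility_distribution X \<pi> \<and> (\<forall>A. A \<subseteq> X \<longrightarrow> P A = induced_measure \<pi> A))"

(* Zero-sum game: player 1 chooses from S, player 2 from T, and a i j is the payoff to player 1.
   Intended for finite S and T. *)
definition pure_equilibrium ::
  "'i set \<Rightarrow> 'j set \<Rightarrow> ('i \<Rightarrow> 'j \<Rightarrow> real) \<Rightarrow> 'i \<times> 'j \<Rightarrow> bool" where
  "pure_equilibrium S T a = (\<lambda>(i, j). i \<in> S \<and> j \<in> T \<and>
     a i j = Max ((\<lambda>i'. a i' j) ` S) \<and> a i j = Min ((\<lambda>j'. a i j') ` T))"

definition has_pure_equilibrium :: "'i set \<Rightarrow> 'j set \<Rightarrow> ('i \<Rightarrow> 'j \<Rightarrow> real) \<Rightarrow> bool" where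
  "has_pure_equilibrium S T a \<longleftrightarrow> (\<exists>s. pure_equilibrium S T a s)"

end

theory Submission
  imports Defs
begin

text \<open>
  Both sides of the equivalence say that minimum and maximum may be exchanged. A possibility
  measure is determined by its values on singletons, and on singletons
  \<open>min \<Pi>\<^sub>1 \<Pi>\<^sub>2\<close> is the pointwise minimum of \<open>\<pi>\<^sub>1\<close> and \<open>\<pi>\<^sub>2\<close>. Hence \<open>min \<Pi>\<^sub>1 \<Pi>\<^sub>2\<close> is a
  possibility measure iff for every non-empty \<open>A\<close> the minimum over \<open>\<alpha>\<close> of the maximum over
  \<open>x \<in> A\<close> of \<open>\<pi>\<^sub>\<alpha> x\<close> equals the maximum over \<open>x \<in> A\<close> of the minimum over \<open>\<alpha>\<close>; normalisation
  of the candidate distribution is this equality at \<open>A = X\<close>, where the left side is 1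
  (lemma \<open>min_possibility_measure_iff\<close>). Up to the sign of the payoff, that equality says
  that the lower and upper values of the game coincide, which for finite games is
  equivalent to the existence of a saddle point (lemma \<open>has_pure_equilibrium_iff_minimax\<close>).
\<close>

text \<open>
  At a saddle point the payoff is both its row minimum, hence at most the lower value, and its
  column maximum, hence at least the upper value; as the lower value never exceeds the upper
  one, the two agree.
  Conversely, a maximin row and a minimax column form a saddle point once the values agree,
  because their common entry lies between the row minimum and the column maximum.
\<close>
lemma has_pure_equilibrium_iff_minimax:
  fixes a :: "'i \<Rightarrow> 'j \<Rightarrow> real"
  assumes S: "finite S" "S \<noteq> {}" and T: "finite T" "T \<noteq> {}"
  shows "has_pure_equilibrium S T a \<longleftrightarrow>
    Max ((\<lambda>i. Min (a i ` T)) ` S) = Min ((\<lambda>j. Max ((\<lambda>i. a i j) ` S)) ` T)"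
    (is "_ \<longleftrightarrow> ?lower = ?upper")
proof -
  define r where "r i = Min (a i ` T)" for i
  define c where "c j = Max ((\<lambda>i. a i j) ` S)" for j
  have r_le: "r i \<le> a i j" if "j \<in> T" for i j
    unfolding r_def using T that by (intro Min_le) auto
  have le_c: "a i j \<le> c j" if "i \<in> S" for i j
    unfolding c_def using S that by (intro Max_ge) auto
  have "Max (r ` S) \<in> r ` S" and "Min (c ` T) \<in> c ` T"
    using S T by simp_all
  then obtain i0 j0 where i0: "i0 \<in> S" "Max (r ` S) = r i0"
    and j0: "j0 \<in> T" "Min (c ` T) = c j0"
    by auto
  have r_max: "r i \<le> r i0" if "i \<in> S" for i
    using S that by (simp flip: i0(2))
  have c_min: "c j0 \<le> c j" if "j \<in> T" for j
    using T that by (simp flip: j0(2))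
  have "has_pure_equilibrium S T a \<longleftrightarrow> (\<exists>i\<in>S. \<exists>j\<in>T. a i j = c j \<and> a i j = r i)"
    unfolding has_pure_equilibrium_def pure_equilibrium_def r_def c_def by auto
  also have "\<dots> \<longleftrightarrow> r i0 = c j0"
  proof
    assume "\<exists>i\<in>S. \<exists>j\<in>T. a i j = c j \<and> a i j = r i"
    then obtain i j where "i \<in> S" "j \<in> T" "a i j = c j" "a i j = r i" by auto
    then show "r i0 = c j0"
      using r_max[of i] c_min[of j] r_le[OF j0(1), of i0] le_c[OF i0(1), of j0] by linarith
  next
    assume "r i0 = c j0"
    then have "a i0 j0 = c j0" "a i0 j0 = r i0"
      using r_le[OF j0(1), of i0] le_c[OF i0(1), of j0] by linarith+
    then show "\<exists>i\<in>S. \<exists>j\<in>T. a i j = c j \<and> a i j = r i"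
      using i0 j0 by blast
  qed
  finally show ?thesis
    using i0 j0 by (simp add: r_def[abs_def] c_def[abs_def])
qed

lemma Min_uminus_image:
  fixes f :: "'a \<Rightarrow> real"
  assumes "finite A" "A \<noteq> {}"
  shows "Min ((\<lambda>x. - f x) ` A) = - Max (f ` A)"
proof -
  have "- Max (f ` A) = Min (uminus ` f ` A)"
    using assms by (intro minus_Max_eq_Min) auto
  then show ?thesis
    by (simp only: image_image)
qed

text \<open>
  For a payoff \<open>- \<pi> \<alpha> x\<close> the first player minimises \<open>\<pi>\<close> and the second one maximises it, so
  the lower value is the negative of the minimum of the two induced measures.
\<close>
lemma has_pure_equilibrium_iff_Max_min:
  fixes \<pi> :: "nat \<Rightarrow> 'a \<Rightarrow> real"
  assumes A: "finite A" "A \<noteq> {}"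
  shows "has_pure_equilibrium {1, 2} A (\<lambda>\<alpha> x. - \<pi> \<alpha> x) \<longleftrightarrow>
    min (induced_measure (\<pi> 1) A) (induced_measure (\<pi> 2) A) =
    induced_measure (\<lambda>x. min (\<pi> 1 x) (\<pi> 2 x)) A"
proof -
  have max_minus: "max (- x) (- y) = - min x y" for x y :: real
    by (simp add: min_def max_def)
  have lower: "Max ((\<lambda>\<alpha>. Min ((\<lambda>x. - \<pi> \<alpha> x) ` A)) ` {1, 2}) =
      - min (induced_measure (\<pi> 1) A) (induced_measure (\<pi> 2) A)"
    using A(2) by (simp only: Min_uminus_image[OF A] image_insert image_empty induced_measure_def
      if_False max_minus Max_insert Max_singleton finite.intros insert_not_empty not_False_eq_True)
  have "Max ((\<lambda>\<alpha>. - \<pi> \<alpha> x) ` {1, 2}) = - min (\<pi> 1 x) (\<pi> 2 x)" for x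
    by (simp only: image_insert image_empty max_minus Max_insert Max_singleton finite.intros
      insert_not_empty not_False_eq_True)
  then have upper: "Min ((\<lambda>x. Max ((\<lambda>\<alpha>. - \<pi> \<alpha> x) ` {1, 2})) ` A) =
      - induced_measure (\<lambda>x. min (\<pi> 1 x) (\<pi> 2 x)) A"
    using A(2) by (simp only: Min_uminus_image[OF A] induced_measure_def if_False)
  have "has_pure_equilibrium {1, 2} A (\<lambda>\<alpha> x. - \<pi> \<alpha> x) \<longleftrightarrow>
      Max ((\<lambda>\<alpha>. Min ((\<lambda>x. - \<pi> \<alpha> x) ` A)) ` {1, 2}) =
      Min ((\<lambda>x. Max ((\<lambda>\<alpha>. - \<pi> \<alpha> x) ` {1, 2})) ` A)"
    using A by (intro has_pure_equilibrium_iff_minimax) auto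
  then show ?thesis
    by (simp only: lower upper neg_equal_iff_equal)
qed

text \<open>
  The only possible inducing distribution is the pointwise minimum, as evaluation on
  singletons shows. Its maximum is 1 because both measures give \<open>X\<close> the value 1.
\<close>
lemma min_possibility_measure_iff:
  assumes p: "possibility_distribution X p" and q: "possibility_distribution X q"
  shows "possibility_measure X (\<lambda>A. min (induced_measure p A) (induced_measure q A)) \<longleftrightarrow>
    (\<forall>A. A \<subseteq> X \<and> A \<noteq> {} \<longrightarrow>
      min (induced_measure p A) (induced_measure q A) = induced_measure (\<lambda>x. min (p x) (q x)) A)"
proof
  assume "possibility_measure X (\<lambda>A. min (induced_measure p A) (induced_measure q A))"
  then obtain d where d: "\<And>A. A \<subseteq> X \<Longrightarrow>
      min (induced_measure p A) (induced_measure q A) = induced_measure d A"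
    unfolding possibility_measure_def by auto
  have d_eq: "d x = min (p x) (q x)" if "x \<in> X" for x
    using d[of "{x}"] that by (simp add: induced_measure_def)
  have "induced_measure d A = induced_measure (\<lambda>x. min (p x) (q x)) A" if "A \<subseteq> X" for A
  proof -
    have "d ` A = (\<lambda>x. min (p x) (q x)) ` A"
      using that by (intro image_cong) (auto simp: d_eq)
    then show ?thesis by (simp add: induced_measure_def)
  qed
  then show "\<forall>A. A \<subseteq> X \<and> A \<noteq> {} \<longrightarrow>
      min (induced_measure p A) (induced_measure q A) = induced_measure (\<lambda>x. min (p x) (q x)) A"
    using d by auto
next
  assume exchange: "\<forall>A. A \<subseteq> X \<and> A \<noteq> {} \<longrightarrow>
      min (induced_measure p A) (induced_measure q A) = induced_measure (\<lambda>x. min (p x) (q x)) A"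
  have "X \<noteq> {}" using p by (simp add: possibility_distribution_def)
  then have "Max ((\<lambda>x. min (p x) (q x)) ` X) = 1"
    using exchange[rule_format, of X] p q
    by (simp add: induced_measure_def possibility_distribution_def)
  then have "possibility_distribution X (\<lambda>x. min (p x) (q x))"
    using p q by (auto simp: possibility_distribution_def min_le_iff_disj)
  moreover have "min (induced_measure p A) (induced_measure q A) =
      induced_measure (\<lambda>x. min (p x) (q x)) A" if "A \<subseteq> X" for A
    using exchange that by (cases "A = {}") (auto simp: induced_measure_def)
  ultimately show "possibility_measure X (\<lambda>A. min (induced_measure p A) (induced_measure q A))"
    unfolding possibility_measure_def by blast
qed

theorem theorem15:
  fixes X :: "'a set" and \<pi> :: "nat \<Rightarrow> 'a \<Rightarrow> real"
  assumes "finite X"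
    and "possibility_distribution X (\<pi> 1)"
    and "possibility_distribution X (\<pi> 2)"
  shows "possibility_measure X (\<lambda>A. min (induced_measure (\<pi> 1) A) (induced_measure (\<pi> 2) A)) \<longleftrightarrow>
    (\<forall>A. A \<subseteq> X \<and> A \<noteq> {} \<longrightarrow> has_pure_equilibrium {1, 2} A (\<lambda>\<alpha> \<beta>. - \<pi> \<alpha> \<beta>))"
  unfolding min_possibility_measure_iff[OF assms(2,3)]
  using has_pure_equilibrium_iff_Max_min[of _ \<pi>] finite_subset[OF _ assms(1)] by blast

end
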